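(* Let $f$ be $L$-smooth, $f\in PL(\mu)$, $g\in\mathrm{ER}(\rho)$, and assume the interpolation condition holds. Then SGD with $\gamma_k=\gamma$, $0<\gamma\le\frac{1}{1+2\rho/\mu}\frac1L$, converges linearly at rate $1-\gamma\mu$: $$\mathbb{E}[f(x^k)-f^*]\le(1-\gamma\mu)^k[f(x^0)-f^*]\quad\text{for all }k\ge0.$$ Consequently, for every $\epsilon>0$, with $\gamma=\frac{1}{1+2\rho/\mu}\frac1L$, one has $\mathbb{E}[f(x^k)-f^*]\le\epsilon$ whenever $$k\ge\frac L\mu\left(1+2\frac\rho\mu\right)\log\left(\frac{f(x^0)-f^*}{\epsilon}\right).$$ If moreover $n\ge2$, each $f_i$ is $L_i$-smooth and $v$ is a $b$-minibatch sampling, then (taking $\rho=L_{\max}\frac{n-b}{(n-1)b}$ in the step size) the total complexity $TC(b)$, i.e. $b$ times the number of iterations sufficient to reach $\mathbb{E}[f(x^k)-f^*]\le\epsilon$, satisfies $$TC(b)\le\frac L\mu\left(b+2\frac{L_{\max}}{\mu}\frac{n-b}{n-1}\right)\log\left(\frac{f(x^0)-f^*}{\epsilon}\right),$$ in the sense that $\mathbb{E}[f(x^k)-f^*]\le\epsilon$ for every $k$ such that $kb$ is at least the right-hand side. Finally, with $\kappa_{\max}:=L_{\max}/\mu$, the minibatch size $b^*\in\{1,\dots,n\}$ that optimizes this total complexity bound is $$b^*=\begin{cases}1&\text{if }n-1\ge2\kappa_{\max},\\ n&\text{if }n-1<2\kappa_{\max}.\end{cases}$$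
   Context: $f_1,\dots,f_n:\mathbb{R}^d\to\mathbb{R}$ are differentiable, $f=\frac1n\sum_if_i$ has a nonempty set $\mathcal{X}^*$ of global minimizers, $f^*=\min f$. A sampling vector is a random vector $v\in\mathbb{R}^n$ with nonnegative entries and $\mathbb{E}[v_i]=1$; $f_v=\frac1n\sum_iv_if_i$, $g(x)=\nabla f_v(x)$. The $b$-minibatch sampling ($1\le b\le n$) has $\mathbb{P}[v=\frac nb\sum_{i\in S}e_i]=1/\binom nb$ for every $S$ with $|S|=b$. SGD from a deterministic $x^0$: $x^{k+1}=x^k-\gamma_k\nabla f_{v^k}(x^k)$, with $v^0,v^1,\dots$ i.i.d. copies of $v$. A function $h$ is $L$-smooth ($L>0$) if $h(z)-h(x)\le\langle\nabla h(x),z-x\rangle+\frac L2\|z-x\|^2$ for all $x,z$; $L_{\max}=\max_iL_i$. $f\in PL(\mu)$, $\mu>0$, means $\|\nabla f(x)\|^2\ge2\mu(f(x)-f^* )$ for all $x$. $g\in\mathrm{ER}(\rho)$, $\rho\ge0$, means that for a fixed $x^*\in\mathcal{X}^*$, $\mathbb{E}\|g(x)-g(x^* )-(\nabla f(x)-\nabla f(x^* ))\|^2\le2\rho(f(x)-f(x^* ))$ for all $x$. Interpolation: there is $x^*\in\mathcal{X}^*$ with $f_i(x^* )=\min_xf_i(x)$ for all $i$.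
   Formalization: The optimality of b* is stated for 0<ε<f(x^0)-f* only: for larger ε the logarithm is negative and the minimizer flips, at equality the bound is identically 0; when n-1=2κ_max, b*=1 is one of several minimizers. *)

theory Defs
  imports "HOL-Probability.Probability"
begin

definition grad :: "('a::real_inner \<Rightarrow> real) \<Rightarrow> 'a \<Rightarrow> 'a" where
  "grad h x = (THE D. GDERIV h x :> D)"

definition minimizers :: "('a \<Rightarrow> real) \<Rightarrow> 'a set" where
  "minimizers h = {x. \<forall>y. h x \<le> h y}"

text \<open>Meant for functions with a minimizer, for which the infimum is the minimum.\<close>

definition min_value :: "('a \<Rightarrow> real) \<Rightarrow> real" where
  "min_value h = (INF x. h x)"

definition average :: "('n::finite \<Rightarrow> 'a \<Rightarrow> real) \<Rightarrow> 'a \<Rightarrow> real" where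
  "average fs x = 1 / real CARD('n) * (\<Sum>i\<in>UNIV. fs i x)"

definition weighted_average :: "('n::finite \<Rightarrow> 'a \<Rightarrow> real) \<Rightarrow> real ^ 'n \<Rightarrow> 'a \<Rightarrow> real" where
  "weighted_average fs w x = 1 / real CARD('n) * (\<Sum>i\<in>UNIV. w $ i * fs i x)"

definition L_smooth :: "real \<Rightarrow> ('a::real_inner \<Rightarrow> real) \<Rightarrow> bool" where
  "L_smooth L h \<longleftrightarrow> 0 < L \<and>
     (\<forall>x z. h z - h x \<le> grad h x \<bullet> (z - x) + L / 2 * (norm (z - x))\<^sup>2)"

definition PL :: "real \<Rightarrow> ('a::real_inner \<Rightarrow> real) \<Rightarrow> bool" where
  "PL \<mu> h \<longleftrightarrow> 0 < \<mu> \<and> (\<forall>x. (norm (grad h x))\<^sup>2 \<ge> 2 * \<mu> * (h x - min_value h))"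

text \<open>The Bochner integral of a non-integrable function is 0, so an upper bound on an
  expectation is always stated together with integrability.\<close>

definition expectation_le :: "'w measure \<Rightarrow> ('w \<Rightarrow> real) \<Rightarrow> real \<Rightarrow> bool" where
  "expectation_le M X c \<longleftrightarrow> integrable M X \<and> (\<integral>\<omega>. X \<omega> \<partial>M) \<le> c"

definition sampling_vector :: "'w measure \<Rightarrow> ('w \<Rightarrow> real ^ 'n::finite) \<Rightarrow> bool" where
  "sampling_vector M v \<longleftrightarrow> prob_space M \<and> v \<in> borel_measurable M \<and>
     (\<forall>i. (AE \<omega> in M. 0 \<le> v \<omega> $ i) \<and>
          integrable M (\<lambda>\<omega>. v \<omega> $ i) \<and> (\<integral>\<omega>. v \<omega> $ i \<partial>M) = 1)"

definition minibatch_sampling :: "nat \<Rightarrow> 'w measure \<Rightarrow> ('w \<Rightarrow> real ^ 'n::finite) \<Rightarrow> bool" where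
  "minibatch_sampling b M v \<longleftrightarrow> sampling_vector M v \<and> 1 \<le> b \<and> b \<le> CARD('n) \<and>
     (\<forall>S. card S = b \<longrightarrow>
        measure M {\<omega> \<in> space M. v \<omega> = (real CARD('n) / real b) *\<^sub>R (\<Sum>i\<in>S. axis i 1)}
          = 1 / real (CARD('n) choose b))"

definition iid_copies ::
  "'p measure \<Rightarrow> (nat \<Rightarrow> 'p \<Rightarrow> real ^ 'n::finite) \<Rightarrow> 'w measure \<Rightarrow> ('w \<Rightarrow> real ^ 'n) \<Rightarrow> bool" where
  "iid_copies P vs M v \<longleftrightarrow> prob_space P \<and>
     prob_space.indep_vars P (\<lambda>_. borel) vs UNIV \<and>
     (\<forall>k. distr P borel (vs k) = distr M borel v)"

text \<open>Expected residual condition for the gradient estimator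
  \<open>g(x) = grad (weighted_average fs v) x\<close> of \<open>grad (average fs) x\<close>.\<close>

definition expected_residual ::
  "real \<Rightarrow> ('n::finite \<Rightarrow> 'a::euclidean_space \<Rightarrow> real) \<Rightarrow> 'w measure \<Rightarrow> ('w \<Rightarrow> real ^ 'n) \<Rightarrow> bool" where
  "expected_residual \<rho> fs M v \<longleftrightarrow> 0 \<le> \<rho> \<and>
     (\<exists>xstar \<in> minimizers (average fs). \<forall>x.
        expectation_le M
          (\<lambda>\<omega>. (norm (grad (weighted_average fs (v \<omega>)) x - grad (weighted_average fs (v \<omega>)) xstar
                       - (grad (average fs) x - grad (average fs) xstar)))\<^sup>2)
          (2 * \<rho> * (average fs x - average fs xstar)))"

definition interpolation :: "('n::finite \<Rightarrow> 'a \<Rightarrow> real) \<Rightarrow> bool" where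
  "interpolation fs \<longleftrightarrow> (\<exists>xstar \<in> minimizers (average fs). \<forall>i. xstar \<in> minimizers (fs i))"

primrec sgd ::
  "('n::finite \<Rightarrow> 'a::real_inner \<Rightarrow> real) \<Rightarrow> (nat \<Rightarrow> real) \<Rightarrow> (nat \<Rightarrow> 'p \<Rightarrow> real ^ 'n) \<Rightarrow> 'a
     \<Rightarrow> nat \<Rightarrow> 'p \<Rightarrow> 'a" where
  "sgd fs \<gamma> vs x0 0 \<omega> = x0"
| "sgd fs \<gamma> vs x0 (Suc k) \<omega> = sgd fs \<gamma> vs x0 k \<omega>
     - \<gamma> k *\<^sub>R grad (weighted_average fs (vs k \<omega>)) (sgd fs \<gamma> vs x0 k \<omega>)"

definition max_step :: "real \<Rightarrow> real \<Rightarrow> real \<Rightarrow> real" where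
  "max_step L \<mu> \<rho> = 1 / (1 + 2 * \<rho> / \<mu>) * (1 / L)"

definition minibatch_rho :: "real \<Rightarrow> nat \<Rightarrow> nat \<Rightarrow> real" where
  "minibatch_rho Lmax n b = Lmax * ((real n - real b) / ((real n - 1) * real b))"

text \<open>Here \<open>\<Delta>\<close> stands for the initial gap \<open>f(x0) - f*\<close>. As \<open>ln 0 = 0\<close>, the bound is 0 if
  \<open>\<Delta> = 0\<close>, where the mathematical value is minus infinity; either way it is at most
  \<open>k * b\<close> for every \<open>k\<close>.\<close>

definition tc_bound :: "real \<Rightarrow> real \<Rightarrow> real \<Rightarrow> nat \<Rightarrow> real \<Rightarrow> real \<Rightarrow> nat \<Rightarrow> real" where
  "tc_bound L \<mu> Lmax n \<Delta> \<epsilon> b =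
     L / \<mu> * (real b + 2 * (Lmax / \<mu>) * ((real n - real b) / (real n - 1))) * ln (\<Delta> / \<epsilon>)"

definition optimal_batch :: "nat \<Rightarrow> real \<Rightarrow> nat" where
  "optimal_batch n \<kappa> = (if real n - 1 \<ge> 2 * \<kappa> then 1 else n)"

end

theory Submission
  imports Defs
begin

text \<open>
  Interpolation forces every \<open>\<nabla>f\<^sub>i\<close> to vanish at every minimizer of \<open>f\<close>, so the expected residual
  condition bounds the variance of the stochastic gradient by \<open>2\<rho>(f(x) - f*)\<close>. Inserted in the
  smoothness inequality and combined with PL, this gives a contraction by \<open>1 - \<gamma>\<mu>\<close> of the expected gap
  conditionally on the current iterate; as the iterate depends on past samples only, the contraction
  survives taking expectations (Tonelli on the product of the two laws). For minibatch sampling, the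
  variance of sampling without replacement and \<open>\<parallel>\<nabla>f\<^sub>i(x)\<parallel>\<^sup>2 \<le> 2L\<^sub>i(f\<^sub>i(x) - min f\<^sub>i)\<close> yield
  the expected residual condition with the stated \<open>\<rho>\<close>, without any convexity.
\<close>

section \<open>Gradients and their measurability\<close>

lemma grad_eqI:
  assumes "GDERIV h x :> D"
  shows "grad h x = D"
  unfolding grad_def
proof (rule the_equality)
  fix D' assume "GDERIV h x :> D'"
  with assms have "(\<lambda>u. u \<bullet> D') = (\<lambda>u. u \<bullet> D)"
    unfolding gderiv_def by (rule has_derivative_unique[rotated])
  then have "\<forall>u. u \<bullet> D' = u \<bullet> D"
    by (rule fun_cong[THEN allI])
  then have "(D' - D) \<bullet> (D' - D) = 0"
    unfolding inner_diff_right by simp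
  then show "D' = D" by simp
qed fact

text \<open>Riesz representation in coordinates: a linear functional on a Euclidean space is the
  inner product with the vector assembled from its values on \<open>Basis\<close>.\<close>

lemma GDERIV_grad:
  fixes h :: "'a::euclidean_space \<Rightarrow> real"
  assumes "h differentiable (at x)"
  shows "GDERIV h x :> grad h x"
proof -
  from assms obtain h' where h': "(h has_derivative h') (at x)"
    by (auto simp: differentiable_def)
  then interpret linear h'
    by (rule has_derivative_linear)
  have "h' u = u \<bullet> (\<Sum>b\<in>Basis. h' b *\<^sub>R b)" for u
    using euclidean_representation[of u] sum[of "\<lambda>b. (u \<bullet> b) *\<^sub>R b" Basis]
    by (simp add: scale inner_sum_right mult.commute)
  then have "h' = (\<lambda>u. u \<bullet> (\<Sum>b\<in>Basis. h' b *\<^sub>R b))" ..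
  with h' have "GDERIV h x :> (\<Sum>b\<in>Basis. h' b *\<^sub>R b)"
    unfolding gderiv_def by simp
  then show ?thesis
    using grad_eqI by metis
qed

lemma grad_eq_0_at_minimizer:
  fixes h :: "'a::euclidean_space \<Rightarrow> real"
  assumes "h differentiable (at x)" "x \<in> minimizers h"
  shows "grad h x = 0"
proof -
  have "(\<lambda>u. u \<bullet> grad h x) = (\<lambda>u. 0)"
    using GDERIV_grad[OF assms(1)] assms(2) unfolding gderiv_def minimizers_def
    by (intro differential_zero_maxmin[of x UNIV h]) auto
  then have "grad h x \<bullet> grad h x = 0"
    by (rule fun_cong)
  then show ?thesis by simp
qed

lemma min_value_eq:
  assumes "x \<in> minimizers h"
  shows "min_value h = h x"
  using assms unfolding min_value_def minimizers_def by (intro cInf_eq_minimum) auto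

lemma borel_measurable_of_differentiable:
  fixes h :: "'a::euclidean_space \<Rightarrow> real"
  assumes "\<And>x. h differentiable (at x)"
  shows "h \<in> borel_measurable borel"
  using assms by (intro borel_measurable_continuous_onI differentiable_imp_continuous_on)
    (simp add: differentiable_on_def)

text \<open>Each component of the gradient is a pointwise limit of difference quotients.\<close>

lemma borel_measurable_grad:
  fixes h :: "'a::euclidean_space \<Rightarrow> real"
  assumes "\<And>x. h differentiable (at x)"
  shows "grad h \<in> borel_measurable borel"
proof (rule borel_measurable_euclidean_space[THEN iffD2], rule ballI)
  fix b :: 'a assume "b \<in> Basis"
  define q where "q n x = (h (x + (1 / real (Suc n)) *\<^sub>R b) - h x) / (1 / real (Suc n))" for n x
  show "(\<lambda>x. grad h x \<bullet> b) \<in> borel_measurable borel"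
  proof (rule borel_measurable_LIMSEQ_real)
    note [measurable] = borel_measurable_of_differentiable[OF assms]
    show "q n \<in> borel_measurable borel" for n
      unfolding q_def by measurable
    fix x
    have "((\<lambda>t. h (x + t *\<^sub>R b)) has_derivative (\<lambda>t. (t *\<^sub>R b) \<bullet> grad h x)) (at 0)"
      by (rule has_derivative_compose[where f = "\<lambda>t. x + t *\<^sub>R b"])
        (use GDERIV_grad[OF assms, of x] in \<open>auto simp: gderiv_def intro!: derivative_eq_intros\<close>)
    then have "((\<lambda>t. h (x + t *\<^sub>R b)) has_real_derivative grad h x \<bullet> b) (at 0)"
      unfolding has_field_derivative_def
      by (rule has_derivative_eq_rhs) (simp add: fun_eq_iff inner_commute)
    then have "((\<lambda>t. (h (x + t *\<^sub>R b) - h x) / t) \<longlongrightarrow> grad h x \<bullet> b) (at 0)"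
      by (simp add: DERIV_def)
    \<comment> \<open>The filter \<open>at 0\<close> is punctured, so the increments must be nonzero
      as well as tend to 0.\<close>
    moreover have "filterlim (\<lambda>n. 1 / real (Suc n)) (at 0) sequentially"
      unfolding filterlim_at using LIMSEQ_inverse_real_of_nat by (simp add: inverse_eq_divide)
    ultimately show "(\<lambda>n. q n x) \<longlonglongrightarrow> grad h x \<bullet> b"
      unfolding q_def by (rule filterlim_compose)
  qed
qed

section \<open>Weighted averages of the component functions\<close>

lemma grad_weighted_average:
  fixes fs :: "'n::finite \<Rightarrow> 'a::euclidean_space \<Rightarrow> real"
  assumes "\<And>i x. fs i differentiable (at x)"
  shows "grad (weighted_average fs w) x
    = (1 / real CARD('n)) *\<^sub>R (\<Sum>i\<in>UNIV. (w $ i) *\<^sub>R grad (fs i) x)"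
proof (rule grad_eqI)
  have "(fs i has_derivative (\<lambda>u. u \<bullet> grad (fs i) x)) (at x)" for i
    using GDERIV_grad[OF assms] by (simp add: gderiv_def)
  then have "(weighted_average fs w has_derivative
      (\<lambda>u. 1 / real CARD('n) * (\<Sum>i\<in>UNIV. w $ i * (u \<bullet> grad (fs i) x)))) (at x)"
    unfolding weighted_average_def by (intro derivative_intros) auto
  then show "GDERIV (weighted_average fs w) x
      :> (1 / real CARD('n)) *\<^sub>R (\<Sum>i\<in>UNIV. (w $ i) *\<^sub>R grad (fs i) x)"
    by (simp add: gderiv_def inner_sum_right)
qed

lemma average_eq_weighted_average: "average fs = weighted_average fs (\<chi> i. 1)"
  by (simp add: average_def weighted_average_def fun_eq_iff)

lemma grad_average:
  fixes fs :: "'n::finite \<Rightarrow> 'a::euclidean_space \<Rightarrow> real"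
  assumes "\<And>i x. fs i differentiable (at x)"
  shows "grad (average fs) x = (1 / real CARD('n)) *\<^sub>R (\<Sum>i\<in>UNIV. grad (fs i) x)"
  unfolding average_eq_weighted_average by (simp add: grad_weighted_average[OF assms])

lemma average_differentiable:
  fixes fs :: "'n::finite \<Rightarrow> 'a::euclidean_space \<Rightarrow> real"
  assumes "\<And>i x. fs i differentiable (at x)"
  shows "average fs differentiable (at x)"
  unfolding average_def using assms by (intro derivative_intros) auto

lemma borel_measurable_vec_nth:
  "(\<lambda>w::real ^ 'n. w $ i) \<in> borel_measurable borel"
  by (intro borel_measurable_continuous_onI continuous_intros)

text \<open>Weights and point may both be random: by the gradient formula, the map is a finite sum
  of products of weight coordinates and measurable component gradients.\<close>

lemma borel_measurable_grad_weighted_average: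
  fixes fs :: "'n::finite \<Rightarrow> 'a::euclidean_space \<Rightarrow> real"
  assumes "\<And>i x. fs i differentiable (at x)"
    and [measurable]: "W \<in> borel_measurable N" "X \<in> borel_measurable N"
  shows "(\<lambda>\<omega>. grad (weighted_average fs (W \<omega>)) (X \<omega>)) \<in> borel_measurable N"
proof -
  have [measurable]: "(\<lambda>\<omega>. grad (fs i) (X \<omega>)) \<in> borel_measurable N" for i
    by (rule measurable_compose[OF assms(3) borel_measurable_grad[OF assms(1)]])
  have [measurable]: "(\<lambda>\<omega>. W \<omega> $ i) \<in> borel_measurable N" for i
    by (rule measurable_compose[OF assms(2) borel_measurable_vec_nth])
  show ?thesis
    unfolding grad_weighted_average[OF assms(1)]
    by (intro borel_measurable_scaleR borel_measurable_sum) simp_all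
qed

section \<open>Consequences of smoothness, PL and interpolation\<close>

text \<open>The gradient step of length \<open>1 / L\<close> minimizes the quadratic upper bound
  given by smoothness, and even there \<open>h\<close> is at least \<open>h x'\<close>.\<close>

lemma L_smooth_grad_bound:
  assumes "L_smooth L h" "x' \<in> minimizers h"
  shows "(norm (grad h x))\<^sup>2 \<le> 2 * L * (h x - h x')"
proof -
  have L: "0 < L" using assms by (simp add: L_smooth_def)
  let ?z = "x - (1 / L) *\<^sub>R grad h x"
  have "h x' - h x \<le> h ?z - h x"
    using assms(2) by (simp add: minimizers_def)
  also have "\<dots> \<le> grad h x \<bullet> (?z - x) + L / 2 * (norm (?z - x))\<^sup>2"
    using assms(1) unfolding L_smooth_def by blast
  also have "\<dots> = - (norm (grad h x))\<^sup>2 / (2 * L)"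
    using L by (simp add: power2_norm_eq_inner[of "grad h x"] field_simps)
      (simp add: power2_eq_square)
  finally show ?thesis
    using L by (simp add: field_simps)
qed

text \<open>Smoothness and PL bound the same squared gradient norm from above and from below. A
  point above the minimum is essential: a constant function satisfies PL for every positive
  \<open>\<mu>\<close>.\<close>

lemma L_smooth_PL_constants_le:
  assumes "L_smooth L h" "PL \<mu> h" "x' \<in> minimizers h" "h x' < h x"
  shows "\<mu> \<le> L"
proof -
  have "2 * \<mu> * (h x - h x') \<le> 2 * L * (h x - h x')"
    using L_smooth_grad_bound[OF assms(1,3), of x] assms(2) unfolding PL_def min_value_eq[OF assms(3)]
    by (meson order_trans)
  with assms(4) show ?thesis by simp
qed

text \<open>The gaps to a common minimizer \<open>x'\<close> are nonnegative and their sum is at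
  most 0, so each of them vanishes. Interpolation thus transfers to whichever minimizer
  \<open>expected_residual\<close> provides.\<close>

lemma interpolation_minimizer:
  fixes fs :: "'n::finite \<Rightarrow> 'a \<Rightarrow> real"
  assumes "interpolation fs" "x \<in> minimizers (average fs)"
  shows "x \<in> minimizers (fs i)"
proof -
  from assms(1) obtain x' where x': "\<And>i y. fs i x' \<le> fs i y"
    unfolding interpolation_def minimizers_def by auto
  have "average fs x \<le> average fs x'"
    using assms(2) by (simp add: minimizers_def)
  then have "(\<Sum>i\<in>UNIV. fs i x) \<le> (\<Sum>i\<in>UNIV. fs i x')"
    by (simp add: average_def divide_right_mono field_simps)
  then have "(\<Sum>i\<in>UNIV. fs i x - fs i x') = 0"
    using sum_mono[of UNIV "\<lambda>i. fs i x'" "\<lambda>i. fs i x"] x' by (simp add: sum_subtractf)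
  then have "fs i x = fs i x'"
    using x' by (subst (asm) sum_nonneg_eq_0_iff) auto
  with x' show ?thesis by (simp add: minimizers_def)
qed

lemma interpolation_grad_eq_0:
  fixes fs :: "'n::finite \<Rightarrow> 'a::euclidean_space \<Rightarrow> real"
  assumes "\<And>i x. fs i differentiable (at x)" "interpolation fs" "x \<in> minimizers (average fs)"
  shows "grad (fs i) x = 0"
  by (intro grad_eq_0_at_minimizer assms interpolation_minimizer)

section \<open>Expected decrease in one step\<close>

lemma max_step_pos:
  assumes "0 < L" "0 < \<mu>" "0 \<le> \<rho>"
  shows "0 < max_step L \<mu> \<rho>"
proof -
  have "0 < 1 + 2 * \<rho> / \<mu>"
    using assms by (simp add: add_pos_nonneg)
  with assms(1) show ?thesis by (simp add: max_step_def)
qed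

text \<open>Under interpolation the residual is the deviation of the stochastic gradient from its mean, so
  the second moment of the stochastic gradient is at most
  \<open>\<parallel>\<nabla>f(x)\<parallel>\<^sup>2 + 2\<rho>(f(x) - f*)\<close>, which PL turns into a multiple of \<open>\<parallel>\<nabla>f(x)\<parallel>\<^sup>2\<close>.\<close>

lemma sgd_expected_step:
  fixes fs :: "'n::finite \<Rightarrow> 'a::euclidean_space \<Rightarrow> real" and v :: "'w \<Rightarrow> real ^ 'n"
  assumes diff: "\<And>i x. fs i differentiable (at x)"
    and samp: "sampling_vector M v"
    and smooth: "L_smooth L (average fs)" and PL: "PL \<mu> (average fs)"
    and interp: "interpolation fs"
    and ER: "expected_residual \<rho> fs M v"
    and \<gamma>: "0 < \<gamma>" "\<gamma> \<le> max_step L \<mu> \<rho>"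
  defines "f \<equiv> average fs"
  shows "(\<integral>\<^sup>+\<omega>. ennreal (f (x - \<gamma> *\<^sub>R grad (weighted_average fs (v \<omega>)) x) - min_value f) \<partial>M)
    \<le> ennreal ((1 - \<gamma> * \<mu>) * (f x - min_value f))"
proof -
  interpret prob_space M using samp by (simp add: sampling_vector_def)
  have L: "0 < L" and \<mu>: "0 < \<mu>" and \<rho>: "0 \<le> \<rho>"
    using smooth PL ER by (auto simp: L_smooth_def PL_def expected_residual_def)
  have \<gamma>_le: "\<gamma> * L * (1 + 2 * \<rho> / \<mu>) \<le> 1"
  proof -
    have "0 < 1 + 2 * \<rho> / \<mu>"
      using \<mu> \<rho> by (simp add: add_pos_nonneg)
    with L have "max_step L \<mu> \<rho> * L * (1 + 2 * \<rho> / \<mu>) = 1"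
      by (simp add: max_step_def)
    moreover have "\<gamma> * L * (1 + 2 * \<rho> / \<mu>) \<le> max_step L \<mu> \<rho> * L * (1 + 2 * \<rho> / \<mu>)"
      using \<gamma>(2) L \<open>0 < 1 + 2 * \<rho> / \<mu>\<close> by (intro mult_right_mono) auto
    ultimately show ?thesis by simp
  qed
  from ER obtain x' where x': "x' \<in> minimizers f"
    and "expectation_le M
          (\<lambda>\<omega>. (norm (grad (weighted_average fs (v \<omega>)) x - grad (weighted_average fs (v \<omega>)) x'
                       - (grad f x - grad f x')))\<^sup>2)
          (2 * \<rho> * (f x - f x'))"
    unfolding expected_residual_def f_def by blast
  define g where "g \<omega> = grad (weighted_average fs (v \<omega>)) x" for \<omega>
  define G where "G = grad f x"
  define \<delta> where "\<delta> = f x - min_value f"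
  have min: "min_value f = f x'" "min_value f \<le> f y" for y
    using x' by (auto simp: min_value_eq minimizers_def)
  \<comment> \<open>All component gradients vanish at \<open>x'\<close>, so the residual is the
    deviation of \<open>g\<close> from \<open>G\<close>.\<close>
  have res: "integrable M (\<lambda>\<omega>. (norm (g \<omega> - G))\<^sup>2)" "(\<integral>\<omega>. (norm (g \<omega> - G))\<^sup>2 \<partial>M) \<le> 2 * \<rho> * \<delta>"
    using \<open>expectation_le M _ _\<close> x' interpolation_grad_eq_0[OF diff interp]
    by (auto simp: expectation_le_def g_def G_def \<delta>_def f_def grad_weighted_average[OF diff]
        grad_average[OF diff] min(1)[unfolded f_def])
  have v: "integrable M (\<lambda>\<omega>. v \<omega> $ i)" "(\<integral>\<omega>. v \<omega> $ i \<partial>M) = 1" for i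
    using samp by (auto simp: sampling_vector_def)
  \<comment> \<open>Unbiasedness tested against \<open>G\<close>: the estimator is linear in the
    weights, each of mean 1.\<close>
  have gG: "integrable M (\<lambda>\<omega>. G \<bullet> g \<omega>)" "(\<integral>\<omega>. G \<bullet> g \<omega> \<partial>M) = (norm G)\<^sup>2"
  proof -
    have *: "(\<lambda>\<omega>. G \<bullet> g \<omega>)
        = (\<lambda>\<omega>. 1 / real CARD('n) * (\<Sum>i\<in>UNIV. v \<omega> $ i * (G \<bullet> grad (fs i) x)))"
      by (simp add: g_def grad_weighted_average[OF diff] inner_sum_right)
    show "integrable M (\<lambda>\<omega>. G \<bullet> g \<omega>)"
      unfolding * by (intro integrable_mult_right Bochner_Integration.integrable_sum
          integrable_mult_left v)
    have "(\<integral>\<omega>. G \<bullet> g \<omega> \<partial>M) = 1 / real CARD('n) * (\<Sum>i\<in>UNIV. G \<bullet> grad (fs i) x)"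
      unfolding * by (simp add: v)
    also have "\<dots> = G \<bullet> G"
      by (subst (3) G_def) (simp add: f_def grad_average[OF diff] inner_sum_right)
    finally show "(\<integral>\<omega>. G \<bullet> g \<omega> \<partial>M) = (norm G)\<^sup>2"
      by (simp add: power2_norm_eq_inner)
  qed
  \<comment> \<open>\<open>Y\<close> is the smoothness bound on the new gap, with the squared norm
    of \<open>g \<omega>\<close> expanded around \<open>G\<close> so that every term is integrable
    with a known or bounded mean.\<close>
  define Y where "Y \<omega> = \<delta> - \<gamma> * (G \<bullet> g \<omega>)
    + L / 2 * \<gamma>\<^sup>2 * ((norm (g \<omega> - G))\<^sup>2 + 2 * (G \<bullet> g \<omega>) - (norm G)\<^sup>2)" for \<omega>
  have Y: "f (x - \<gamma> *\<^sub>R g \<omega>) - min_value f \<le> Y \<omega>" for \<omega>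
  proof -
    have "f (x - \<gamma> *\<^sub>R g \<omega>) - f x
        \<le> G \<bullet> (x - \<gamma> *\<^sub>R g \<omega> - x) + L / 2 * (norm (x - \<gamma> *\<^sub>R g \<omega> - x))\<^sup>2"
      using smooth unfolding L_smooth_def f_def G_def by blast
    moreover have "(norm (g \<omega>))\<^sup>2 = (norm (g \<omega> - G))\<^sup>2 + 2 * (G \<bullet> g \<omega>) - (norm G)\<^sup>2"
      by (simp add: power2_norm_eq_inner inner_diff inner_commute)
    ultimately show ?thesis
      by (simp add: Y_def \<delta>_def power_mult_distrib)
  qed
  have Y_int: "integrable M Y"
    unfolding Y_def by (intro Bochner_Integration.integrable_add Bochner_Integration.integrable_diff
        integrable_mult_right integrable_const gG res)
  have "(\<integral>\<omega>. Y \<omega> \<partial>M) = \<delta> - \<gamma> * (norm G)\<^sup>2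
      + L / 2 * \<gamma>\<^sup>2 * ((\<integral>\<omega>. (norm (g \<omega> - G))\<^sup>2 \<partial>M) + (norm G)\<^sup>2)"
    unfolding Y_def using gG res by (simp add: prob_space)
  also have "\<dots> \<le> \<delta> - \<gamma> * (norm G)\<^sup>2 + L / 2 * \<gamma>\<^sup>2 * (2 * \<rho> * \<delta> + (norm G)\<^sup>2)"
    using L \<gamma> res by (intro add_mono mult_left_mono) auto
  also have "\<dots> \<le> (1 - \<gamma> * \<mu>) * \<delta>"
  proof -
    have G: "2 * \<mu> * \<delta> \<le> (norm G)\<^sup>2"
      using PL by (simp add: PL_def f_def G_def \<delta>_def)
    then have "\<rho> / \<mu> * (2 * \<mu> * \<delta>) \<le> \<rho> / \<mu> * (norm G)\<^sup>2"
      using \<mu> \<rho> by (intro mult_left_mono) auto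
    then have "2 * \<rho> * \<delta> + (norm G)\<^sup>2 \<le> (1 + \<rho> / \<mu>) * (norm G)\<^sup>2"
      using \<mu> by (simp add: algebra_simps)
    also have "\<dots> \<le> (1 + 2 * \<rho> / \<mu>) * (norm G)\<^sup>2"
      using \<mu> \<rho> by (intro mult_right_mono) (auto simp: divide_right_mono)
    finally have "L / 2 * \<gamma>\<^sup>2 * (2 * \<rho> * \<delta> + (norm G)\<^sup>2)
        \<le> L / 2 * \<gamma>\<^sup>2 * ((1 + 2 * \<rho> / \<mu>) * (norm G)\<^sup>2)"
      using L by (intro mult_left_mono) auto
    \<comment> \<open>The step size restriction lets the quadratic term consume at most half of the
      descent \<open>\<gamma> * (norm G)\<^sup>2\<close>; PL converts the other half into
      \<open>\<gamma> * \<mu> * \<delta>\<close>.\<close>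
    also have "\<dots> = (\<gamma> * L * (1 + 2 * \<rho> / \<mu>)) * (\<gamma> / 2 * (norm G)\<^sup>2)"
      by (simp add: power2_eq_square)
    also have "\<dots> \<le> 1 * (\<gamma> / 2 * (norm G)\<^sup>2)"
      using \<gamma>_le \<gamma> by (intro mult_right_mono) auto
    finally have "\<delta> - \<gamma> * (norm G)\<^sup>2 + L / 2 * \<gamma>\<^sup>2 * (2 * \<rho> * \<delta> + (norm G)\<^sup>2)
        \<le> \<delta> - \<gamma> / 2 * (norm G)\<^sup>2"
      by (simp add: algebra_simps)
    also have "\<gamma> / 2 * (2 * \<mu> * \<delta>) \<le> \<gamma> / 2 * (norm G)\<^sup>2"
      using G \<gamma> by (intro mult_left_mono) auto
    then have "\<delta> - \<gamma> / 2 * (norm G)\<^sup>2 \<le> (1 - \<gamma> * \<mu>) * \<delta>"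
      by (simp add: algebra_simps)
    finally show ?thesis .
  qed
  finally have "(\<integral>\<omega>. Y \<omega> \<partial>M) \<le> (1 - \<gamma> * \<mu>) * \<delta>" .
  \<comment> \<open>\<open>Y\<close> dominates a nonnegative gap, so its Bochner and nonnegative
    integrals agree.\<close>
  moreover have "0 \<le> Y \<omega>" for \<omega>
    using Y[of \<omega>] min(2)[of "x - \<gamma> *\<^sub>R g \<omega>"] by linarith
  then have "(\<integral>\<^sup>+\<omega>. ennreal (Y \<omega>) \<partial>M) = ennreal (\<integral>\<omega>. Y \<omega> \<partial>M)"
    using Y_int by (intro nn_integral_eq_integral) auto
  moreover have "(\<integral>\<^sup>+\<omega>. ennreal (f (x - \<gamma> *\<^sub>R g \<omega>) - min_value f) \<partial>M) \<le> (\<integral>\<^sup>+\<omega>. ennreal (Y \<omega>) \<partial>M)"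
    using Y by (intro nn_integral_mono ennreal_leI)
  ultimately have "(\<integral>\<^sup>+\<omega>. ennreal (f (x - \<gamma> *\<^sub>R g \<omega>) - min_value f) \<partial>M)
      \<le> ennreal ((1 - \<gamma> * \<mu>) * \<delta>)"
    by (simp add: ennreal_leI order_trans)
  then show ?thesis
    unfolding g_def \<delta>_def .
qed

section \<open>Independence of the iterate from the next sample\<close>

text \<open>The joint law of independent variables is the product of their laws, so Tonelli applies.
  The inner integral over a second copy of the space freezes \<open>X\<close>, in place of a
  conditional expectation.\<close>

lemma (in prob_space) nn_integral_indep_var:
  assumes "indep_var S X T Y" and h: "h \<in> borel_measurable (S \<Otimes>\<^sub>M T)"
  shows "(\<integral>\<^sup>+\<omega>. h (X \<omega>, Y \<omega>) \<partial>M) = (\<integral>\<^sup>+\<omega>. \<integral>\<^sup>+\<eta>. h (X \<omega>, Y \<eta>) \<partial>M \<partial>M)"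
proof -
  have [measurable]: "X \<in> measurable M S" "Y \<in> measurable M T"
    and *: "distr M S X \<Otimes>\<^sub>M distr M T Y = distr M (S \<Otimes>\<^sub>M T) (\<lambda>x. (X x, Y x))"
    using assms(1) by (auto simp: indep_var_distribution_eq)
  interpret Y: prob_space "distr M T Y" by (rule prob_space_distr) simp
  note h[measurable]
  have "sets (distr M S X \<Otimes>\<^sub>M distr M T Y) = sets (S \<Otimes>\<^sub>M T)"
    by (intro sets_pair_measure_cong) auto
  then have h': "h \<in> borel_measurable (distr M S X \<Otimes>\<^sub>M distr M T Y)"
    using h measurable_cong_sets by blast
  have "(\<integral>\<^sup>+\<omega>. h (X \<omega>, Y \<omega>) \<partial>M) = (\<integral>\<^sup>+z. h z \<partial>(distr M S X \<Otimes>\<^sub>M distr M T Y))"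
    unfolding * by (simp add: nn_integral_distr)
  also have "\<dots> = (\<integral>\<^sup>+x. \<integral>\<^sup>+y. h (x, y) \<partial>distr M T Y \<partial>distr M S X)"
    by (rule Y.nn_integral_fst[symmetric, OF h'])
  also have "\<dots> = (\<integral>\<^sup>+x. \<integral>\<^sup>+\<eta>. h (x, Y \<eta>) \<partial>M \<partial>distr M S X)"
    by (intro nn_integral_cong nn_integral_distr) auto
  also have "\<dots> = (\<integral>\<^sup>+\<omega>. \<integral>\<^sup>+\<eta>. h (X \<omega>, Y \<eta>) \<partial>M \<partial>M)"
    by (intro nn_integral_distr) auto
  finally show ?thesis .
qed

text \<open>Measurability is asked only of the samples before \<open>k\<close>, so that the lemma
  also applies on the finite product space of the first \<open>k\<close> samples.\<close>

lemma borel_measurable_sgd: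
  fixes fs :: "'n::finite \<Rightarrow> 'a::euclidean_space \<Rightarrow> real"
  assumes "\<And>i x. fs i differentiable (at x)" "\<And>i. i < k \<Longrightarrow> vs i \<in> borel_measurable N"
  shows "sgd fs \<gamma> vs x0 k \<in> borel_measurable N"
  using assms(2)
proof (induction k)
  case (Suc k)
  then have [measurable]: "sgd fs \<gamma> vs x0 k \<in> borel_measurable N" by simp
  have [measurable]: "(\<lambda>\<omega>. grad (weighted_average fs (vs k \<omega>)) (sgd fs \<gamma> vs x0 k \<omega>))
      \<in> borel_measurable N"
    using Suc.prems by (intro borel_measurable_grad_weighted_average assms(1)) auto
  have "sgd fs \<gamma> vs x0 (Suc k) = (\<lambda>\<omega>. sgd fs \<gamma> vs x0 k \<omega>
     - \<gamma> k *\<^sub>R grad (weighted_average fs (vs k \<omega>)) (sgd fs \<gamma> vs x0 k \<omega>))"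
    by (simp add: fun_eq_iff)
  then show ?case by simp
next
  case 0
  have "sgd fs \<gamma> vs x0 0 = (\<lambda>_. x0)"
    by (simp add: fun_eq_iff)
  then show ?case by simp
qed

text \<open>The two runs may live on different sample spaces; this identifies a run on the original
  space with one on the space of sample sequences.\<close>

lemma sgd_cong:
  assumes "\<And>i. i < k \<Longrightarrow> vs i \<omega> = ws i \<eta>"
  shows "sgd fs \<gamma> vs x0 k \<omega> = sgd fs \<gamma> ws x0 k \<eta>"
  using assms by (induction k) auto

text \<open>The iterate is a function of the past samples alone: it is the same recursion run on the sample
  sequences themselves, with the coordinate projections as sampling vectors.\<close>

lemma (in prob_space) nn_integral_sgd_sample:
  fixes fs :: "'n::finite \<Rightarrow> 'e::euclidean_space \<Rightarrow> real"
  assumes "\<And>i x. fs i differentiable (at x)" and ind: "indep_vars (\<lambda>_. borel) vs UNIV"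
    and h[measurable]: "h \<in> borel_measurable (borel \<Otimes>\<^sub>M borel)"
  shows "(\<integral>\<^sup>+\<omega>. h (sgd fs \<gamma> vs x0 k \<omega>, vs k \<omega>) \<partial>M)
    = (\<integral>\<^sup>+\<omega>. \<integral>\<^sup>+\<eta>. h (sgd fs \<gamma> vs x0 k \<omega>, vs k \<eta>) \<partial>M \<partial>M)"
proof -
  let ?F = "sgd fs \<gamma> (\<lambda>i u. u i) x0 k"
  let ?H = "\<lambda>z. h (?F (fst z), snd z k)"
  have F: "?F (\<lambda>i\<in>{..<k}. vs i \<omega>) = sgd fs \<gamma> vs x0 k \<omega>" for \<omega>
    by (rule sgd_cong) simp
  have [measurable]: "?F \<in> borel_measurable (PiM {..<k} (\<lambda>_. borel))"
    by (intro borel_measurable_sgd assms(1)) (auto intro: measurable_component_singleton)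
  have [measurable]: "(\<lambda>u. u k) \<in> borel_measurable (PiM {k} (\<lambda>_. borel))"
    by (auto intro: measurable_component_singleton)
  have "?H \<in> borel_measurable (PiM {..<k} (\<lambda>_. borel) \<Otimes>\<^sub>M PiM {k} (\<lambda>_. borel))"
    by measurable
  \<comment> \<open>The past \<open>{..<k}\<close> and the present \<open>{k}\<close> are disjoint
    index sets, hence give independent blocks of samples.\<close>
  from nn_integral_indep_var[OF indep_var_restrict[OF ind] this] show ?thesis
    by (simp add: F)
qed

section \<open>Linear convergence rate\<close>

lemma sgd_linear_rate:
  fixes fs :: "'n::finite \<Rightarrow> 'a::euclidean_space \<Rightarrow> real" and v :: "'w \<Rightarrow> real ^ 'n"
  assumes diff: "\<And>i x. fs i differentiable (at x)"
    and samp: "sampling_vector M v" and iid: "iid_copies P vs M v"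
    and smooth: "L_smooth L (average fs)" and PL: "PL \<mu> (average fs)"
    and interp: "interpolation fs"
    and ER: "expected_residual \<rho> fs M v"
    and \<gamma>: "0 < \<gamma>" "\<gamma> \<le> max_step L \<mu> \<rho>"
  defines "f \<equiv> average fs"
  shows "expectation_le P (\<lambda>\<omega>. f (sgd fs (\<lambda>_. \<gamma>) vs x0 k \<omega>) - min_value f)
    ((1 - \<gamma> * \<mu>) ^ k * (f x0 - min_value f))"
proof -
  interpret prob_space P using iid by (simp add: iid_copies_def)
  have ind: "indep_vars (\<lambda>_. borel) vs UNIV"
    and distr: "\<And>k. distr P borel (vs k) = distr M borel v"
    using iid by (auto simp: iid_copies_def)
  have [measurable]: "vs k \<in> borel_measurable P" for k
    using ind by (auto simp: indep_vars_def)
  have [measurable]: "v \<in> borel_measurable M"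
    using samp by (simp add: sampling_vector_def)
  have [measurable]: "f \<in> borel_measurable borel"
    unfolding f_def by (intro borel_measurable_of_differentiable average_differentiable diff)
  from ER obtain x' where x': "x' \<in> minimizers f"
    unfolding expected_residual_def f_def by blast
  have min: "min_value f = f x'" "min_value f \<le> f y" for y
    using x' by (auto simp: min_value_eq minimizers_def)
  let ?X = "sgd fs (\<lambda>_. \<gamma>) vs x0"
  have X[measurable]: "?X k \<in> borel_measurable P" for k
    by (intro borel_measurable_sgd diff) auto
  show ?thesis
  \<comment> \<open>For constant \<open>f\<close> both sides are 0, while
    \<open>\<mu> \<le> L\<close> and the sign of \<open>1 - \<gamma> * \<mu>\<close> are not
    guaranteed.\<close>
  proof (cases "\<forall>x. f x = min_value f")
    case True
    then show ?thesis by (simp add: expectation_le_def)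
  next
    case False
    then obtain x where "f x' < f x"
      using min by (metis order_le_less)
    then have "\<mu> \<le> L"
      using L_smooth_PL_constants_le[OF smooth PL] x' unfolding f_def by blast
    have q: "0 \<le> 1 - \<gamma> * \<mu>"
    proof -
      have "0 < L" "0 < \<mu>" "0 \<le> \<rho>"
        using smooth PL ER by (auto simp: L_smooth_def PL_def expected_residual_def)
      then have "max_step L \<mu> \<rho> \<le> 1 * (1 / L)"
        unfolding max_step_def by (intro mult_right_mono) (auto simp: divide_le_eq_1)
      with \<gamma> have "\<gamma> * \<mu> \<le> (1 / L) * L"
        using \<open>\<mu> \<le> L\<close> \<open>0 < \<mu>\<close> \<open>0 < L\<close> by (intro mult_mono) auto
      then show ?thesis
        using \<open>0 < L\<close> by simp
    qed
    have "(\<integral>\<^sup>+\<omega>. ennreal (f (?X k \<omega>) - min_value f) \<partial>P)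
        \<le> ennreal ((1 - \<gamma> * \<mu>) ^ k * (f x0 - min_value f))"
    proof (induction k)
      case 0
      then show ?case by (simp add: emeasure_space_1)
    next
      case (Suc k)
      define h where
        "h = (\<lambda>(y, w). ennreal (f (y - \<gamma> *\<^sub>R grad (weighted_average fs w) y) - min_value f))"
      have [measurable]: "(\<lambda>z. grad (weighted_average fs (snd z)) (fst z))
          \<in> borel_measurable (borel \<Otimes>\<^sub>M borel)"
        by (intro borel_measurable_grad_weighted_average diff) auto
      have h: "h \<in> borel_measurable (borel \<Otimes>\<^sub>M borel)"
        unfolding h_def case_prod_beta by measurable
      have "(\<integral>\<^sup>+\<omega>. ennreal (f (?X (Suc k) \<omega>) - min_value f) \<partial>P) = (\<integral>\<^sup>+\<omega>. h (?X k \<omega>, vs k \<omega>) \<partial>P)"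
        by (simp add: h_def)
      also have "\<dots> = (\<integral>\<^sup>+\<omega>. \<integral>\<^sup>+\<eta>. h (?X k \<omega>, vs k \<eta>) \<partial>P \<partial>P)"
        by (intro nn_integral_sgd_sample diff ind h)
      \<comment> \<open>The inner integral depends on \<open>vs k\<close> only through its law,
        which is that of \<open>v\<close>; this makes the one-step bound on \<open>M\<close>
        applicable.\<close>
      also have "\<dots> = (\<integral>\<^sup>+\<omega>. \<integral>\<^sup>+w. h (?X k \<omega>, w) \<partial>distr P borel (vs k) \<partial>P)"
        using h by (intro nn_integral_cong nn_integral_distr[symmetric]) auto
      also have "\<dots> = (\<integral>\<^sup>+\<omega>. \<integral>\<^sup>+\<eta>. h (?X k \<omega>, v \<eta>) \<partial>M \<partial>P)"
        unfolding distr using h by (intro nn_integral_cong nn_integral_distr) auto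
      also have "\<dots> \<le> (\<integral>\<^sup>+\<omega>. ennreal ((1 - \<gamma> * \<mu>) * (f (?X k \<omega>) - min_value f)) \<partial>P)"
        unfolding h_def prod.case f_def
        by (intro nn_integral_mono sgd_expected_step[OF diff samp smooth PL interp ER \<gamma>])
      also have "\<dots> = ennreal (1 - \<gamma> * \<mu>) * (\<integral>\<^sup>+\<omega>. ennreal (f (?X k \<omega>) - min_value f) \<partial>P)"
        using q by (simp add: ennreal_mult' nn_integral_cmult)
      also have "\<dots> \<le> ennreal (1 - \<gamma> * \<mu>) * ennreal ((1 - \<gamma> * \<mu>) ^ k * (f x0 - min_value f))"
        by (intro mult_left_mono Suc) auto
      also have "\<dots> = ennreal ((1 - \<gamma> * \<mu>) ^ Suc k * (f x0 - min_value f))"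
        using q by (simp flip: ennreal_mult' add: mult.assoc)
      finally show ?case .
    qed
    note bound = this
    have int: "integrable P (\<lambda>\<omega>. f (?X k \<omega>) - min_value f)"
    proof (rule integrableI_nonneg)
      show "(\<integral>\<^sup>+\<omega>. ennreal (f (?X k \<omega>) - min_value f) \<partial>P) < \<infinity>"
        using bound by (rule le_less_trans) simp
    qed (use min(2) in auto)
    have "(\<integral>\<^sup>+\<omega>. ennreal (f (?X k \<omega>) - min_value f) \<partial>P)
        = ennreal (\<integral>\<omega>. f (?X k \<omega>) - min_value f \<partial>P)"
      using min(2) by (intro nn_integral_eq_integral[OF int]) auto
    moreover have "0 \<le> (1 - \<gamma> * \<mu>) ^ k * (f x0 - min_value f)"
      using q min(2)[of x0] by simp
    ultimately have "(\<integral>\<omega>. f (?X k \<omega>) - min_value f \<partial>P) \<le> (1 - \<gamma> * \<mu>) ^ k * (f x0 - min_value f)"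
      using bound by simp
    with int show ?thesis
      unfolding expectation_le_def by blast
  qed
qed

section \<open>Expectations under minibatch sampling\<close>

definition minibatch_vector :: "nat \<Rightarrow> 'n set \<Rightarrow> real ^ 'n::finite" where
  "minibatch_vector b S = (real CARD('n) / real b) *\<^sub>R (\<Sum>i\<in>S. axis i 1)"

lemma minibatch_vector_nth:
  "minibatch_vector b S $ i = (if i \<in> S then real CARD('n) / real b else 0)"
  for S :: "'n::finite set"
proof -
  have "(\<Sum>j\<in>S. axis j (1::real) $ i) = (if i \<in> S then 1 else 0)"
    by (simp add: axis_def if_distrib cong: if_cong)
  then show ?thesis by (simp add: minibatch_vector_def)
qed

text \<open>The point masses in the definition belong to disjoint events and add up to 1. So
  \<open>v\<close> is almost surely one of the vectors \<open>minibatch_vector b S\<close>, and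
  expectations are uniform averages over batches.\<close>

lemma integral_minibatch_sampling:
  fixes v :: "'w \<Rightarrow> real ^ 'n::finite" and h :: "real ^ 'n \<Rightarrow> real"
  assumes mb: "minibatch_sampling b M v" and h [measurable]: "h \<in> borel_measurable borel"
  shows "integrable M (\<lambda>\<omega>. h (v \<omega>))"
    and "(\<integral>\<omega>. h (v \<omega>) \<partial>M)
      = (\<Sum>S | card S = b. h (minibatch_vector b S)) / real (CARD('n) choose b)"
proof -
  interpret prob_space M using mb by (simp add: minibatch_sampling_def sampling_vector_def)
  have [measurable]: "v \<in> borel_measurable M"
    using mb by (simp add: minibatch_sampling_def sampling_vector_def)
  have b: "1 \<le> b" "b \<le> CARD('n)"
    using mb by (auto simp: minibatch_sampling_def)
  define N where "N = real (CARD('n) choose b)"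
  have N: "N > 0" using b by (simp add: N_def)
  define A where "A S = {\<omega> \<in> space M. v \<omega> = minibatch_vector b S}" for S
  have [measurable]: "A S \<in> sets M" for S unfolding A_def by measurable
  have prob_A: "prob (A S) = 1 / N" if "card S = b" for S
    using mb that by (simp add: minibatch_sampling_def A_def N_def minibatch_vector_def)
  \<comment> \<open>A batch is recovered as the support of its vector, whose entries on the batch
    are nonzero.\<close>
  have "S = T" if "minibatch_vector b S = minibatch_vector b T" for S T :: "'n set"
  proof (rule set_eqI)
    fix i show "i \<in> S \<longleftrightarrow> i \<in> T"
      using arg_cong[OF that, of "\<lambda>w. w $ i"] b
      by (auto simp: minibatch_vector_nth split: if_splits)
  qed
  then have disj: "disjoint_family_on A {S. card S = b}"
    by (fastforce simp: disjoint_family_on_def A_def)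
  have card: "card {S :: 'n set. card S = b} = CARD('n) choose b"
    using n_subsets[of "UNIV :: 'n set" b] by simp
  have "prob (\<Union>S\<in>{S. card S = b}. A S) = (\<Sum>S | card S = b. prob (A S))"
    using disj by (intro finite_measure_finite_Union) auto
  also have "\<dots> = 1"
    using N by (simp add: prob_A card flip: N_def)
  finally have "AE \<omega> in M. \<omega> \<in> (\<Union>S\<in>{S. card S = b}. A S)"
    by (rule AE_prob_1)
  define R where "R \<omega> = (\<Sum>S | card S = b. h (minibatch_vector b S) * indicator (A S) \<omega>)" for \<omega>
  from \<open>AE \<omega> in M. \<omega> \<in> _\<close> have AE: "AE \<omega> in M. h (v \<omega>) = R \<omega>"
  proof eventually_elim
    case (elim \<omega>)
    then obtain T where T: "card T = b" "\<omega> \<in> A T" by auto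
    then have "indicator (A S) \<omega> = (if S = T then 1 else 0 :: real)" if "card S = b" for S
      using disj that by (auto simp: disjoint_family_on_def indicator_def)
    then have "(\<Sum>S | card S = b. h (minibatch_vector b S) * indicator (A S) \<omega>)
        = (\<Sum>S | card S = b. if S = T then h (minibatch_vector b S) else 0)"
      by (intro sum.cong) auto
    also have "\<dots> = h (v \<omega>)"
      using T by (simp add: A_def)
    finally show ?case by (simp add: R_def)
  qed
  have A_int: "integrable M (indicator (A S) :: _ \<Rightarrow> real)" for S
    by (intro integrable_real_indicator) (auto simp: less_top[symmetric])
  then have "integrable M R"
    unfolding R_def by (intro Bochner_Integration.integrable_sum integrable_mult_right)
  moreover from this have [measurable]: "R \<in> borel_measurable M"
    by (rule borel_measurable_integrable)
  ultimately show "integrable M (\<lambda>\<omega>. h (v \<omega>))"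
    by (subst integrable_cong_AE[OF _ _ AE]) auto
  have "(\<integral>\<omega>. h (v \<omega>) \<partial>M) = (\<integral>\<omega>. R \<omega> \<partial>M)"
    by (intro integral_cong_AE AE) auto
  also have "\<dots> = (\<Sum>S | card S = b. h (minibatch_vector b S) / N)"
    unfolding R_def by (subst Bochner_Integration.integral_sum) (auto simp: prob_A A_int)
  finally show "(\<integral>\<omega>. h (v \<omega>) \<partial>M)
      = (\<Sum>S | card S = b. h (minibatch_vector b S)) / real (CARD('n) choose b)"
    by (simp add: sum_divide_distrib N_def)
qed

section \<open>Counting batches and second moments of batch sums\<close>

text \<open>Removing \<open>i\<close> leaves a subset of size \<open>b - 1\<close> of the other
  indices; \<open>1 \<le> b\<close> makes the truncated subtraction exact.\<close>

lemma card_subsets_containing: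
  fixes i :: "'n::finite"
  assumes "1 \<le> b"
  shows "card {S. card S = b \<and> i \<in> S} = (CARD('n) - 1) choose (b - 1)"
proof -
  have "bij_betw (insert i) {S. S \<subseteq> UNIV - {i} \<and> card S = b - 1} {S. card S = b \<and> i \<in> S}"
    by (rule bij_betw_byWitness[where f' = "\<lambda>S. S - {i}"])
      (use assms in \<open>auto simp: card_insert_if\<close>)
  then show ?thesis
    by (simp add: bij_betw_same_card[symmetric] n_subsets)
qed

lemma card_subsets_separating:
  fixes i j :: "'n::finite"
  assumes "1 \<le> b" "i \<noteq> j"
  shows "card {S. card S = b \<and> i \<in> S \<and> j \<notin> S} = (CARD('n) - 2) choose (b - 1)"
proof -
  have "bij_betw (insert i) {S. S \<subseteq> UNIV - {i, j} \<and> card S = b - 1}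
      {S. card S = b \<and> i \<in> S \<and> j \<notin> S}"
    by (rule bij_betw_byWitness[where f' = "\<lambda>S. S - {i}"])
      (use assms in \<open>auto simp: card_insert_if\<close>)
  moreover have "card (UNIV - {i, j}) = CARD('n) - 2"
    using assms by (simp add: card_Diff_subset)
  ultimately show ?thesis
    by (simp add: bij_betw_same_card[symmetric] n_subsets)
qed

text \<open>For \<open>i \<noteq> j\<close> the number of sets containing both indices differs from the number of sets
  containing \<open>i\<close> by a constant, and constant coefficients drop out as the vectors sum to zero.\<close>

lemma sum_subsets_norm_squared:
  fixes c :: "'n::finite \<Rightarrow> 'a::real_inner"
  assumes "1 \<le> b" "(\<Sum>i\<in>UNIV. c i) = 0"
  shows "(\<Sum>S | card S = b. (norm (\<Sum>i\<in>S. c i))\<^sup>2)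
    = real ((CARD('n) - 2) choose (b - 1)) * (\<Sum>i\<in>UNIV. (norm (c i))\<^sup>2)"
proof -
  \<comment> \<open>\<open>N\<close> counts the batches containing a given index, \<open>D\<close>
    those that also avoid a second one, so \<open>N - D\<close> counts the batches containing
    both.\<close>
  define N where "N = real ((CARD('n) - 1) choose (b - 1))"
  define D where "D = real ((CARD('n) - 2) choose (b - 1))"
  have count: "real (card {S. card S = b \<and> i \<in> S \<and> j \<in> S}) = N - D + (if i = j then D else 0)"
    for i j :: 'n
  proof (cases "i = j")
    case False
    have "{S. card S = b \<and> i \<in> S}
        = {S. card S = b \<and> i \<in> S \<and> j \<in> S} \<union> {S. card S = b \<and> i \<in> S \<and> j \<notin> S}"
      by auto
    then have "card {S. card S = b \<and> i \<in> S}
        = card {S. card S = b \<and> i \<in> S \<and> j \<in> S} + card {S. card S = b \<and> i \<in> S \<and> j \<notin> S}"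
      by (simp add: card_Un_disjoint disjoint_iff)
    with False show ?thesis
      using card_subsets_containing[OF assms(1), of i]
        card_subsets_separating[OF assms(1) False] by (simp add: N_def D_def)
  qed (simp add: N_def card_subsets_containing[OF assms(1)])
  have "(\<Sum>S | card S = b. (norm (\<Sum>i\<in>S. c i))\<^sup>2)
      = (\<Sum>S | card S = b. \<Sum>i\<in>UNIV. \<Sum>j\<in>UNIV. (if i \<in> S \<and> j \<in> S then c i \<bullet> c j else 0))"
  proof (intro sum.cong refl)
    fix S :: "'n set"
    have "(\<Sum>i\<in>S. c i) = (\<Sum>i\<in>UNIV. if i \<in> S then c i else 0)"
      by (simp add: sum.If_cases)
    then have "(norm (\<Sum>i\<in>S. c i))\<^sup>2
        = (\<Sum>i\<in>UNIV. if i \<in> S then c i else 0) \<bullet> (\<Sum>j\<in>UNIV. if j \<in> S then c j else 0)"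
      by (simp add: power2_norm_eq_inner)
    also have "\<dots> = (\<Sum>i\<in>UNIV. \<Sum>j\<in>UNIV. (if i \<in> S \<and> j \<in> S then c i \<bullet> c j else 0))"
      unfolding inner_sum_left by (intro sum.cong refl) (auto simp: inner_sum_right intro!: sum.cong)
    finally show "(norm (\<Sum>i\<in>S. c i))\<^sup>2
        = (\<Sum>i\<in>UNIV. \<Sum>j\<in>UNIV. (if i \<in> S \<and> j \<in> S then c i \<bullet> c j else 0))" .
  qed
  \<comment> \<open>Two exchanges move the sum over batches innermost, where it becomes a count for
    each pair of indices.\<close>
  also have "\<dots> = (\<Sum>i\<in>UNIV. \<Sum>j\<in>UNIV. \<Sum>S | card S = b. if i \<in> S \<and> j \<in> S then c i \<bullet> c j else 0)"
    by (subst sum.swap, intro sum.cong refl, rule sum.swap)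
  also have "\<dots> = (\<Sum>i\<in>UNIV. \<Sum>j\<in>UNIV. (N - D + (if i = j then D else 0)) * (c i \<bullet> c j))"
    by (intro sum.cong refl)
      (simp add: sum.If_cases flip: count; simp add: Collect_conj_eq Int_assoc)
  also have "\<dots> = (N - D) * ((\<Sum>i\<in>UNIV. c i) \<bullet> (\<Sum>j\<in>UNIV. c j)) + D * (\<Sum>i\<in>UNIV. c i \<bullet> c i)"
  proof -
    have "(\<Sum>i\<in>UNIV. c i) \<bullet> (\<Sum>j\<in>UNIV. c j) = (\<Sum>i\<in>UNIV. \<Sum>j\<in>UNIV. c i \<bullet> c j)"
      by (simp only: inner_sum_left) (simp only: inner_sum_right)
    then show ?thesis
      by (simp add: distrib_right sum.distrib sum_distrib_left if_distrib[of "\<lambda>t. t * _"]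
          cong: if_cong)
  qed
  finally show ?thesis
    using assms(2) by (simp add: D_def power2_norm_eq_inner)
qed

text \<open>Centering at the mean subtracts \<open>CARD('n) * (m \<bullet> m)\<close> from the sum
  of squares.\<close>

lemma sum_norm_squared_centered_le:
  fixes a :: "'n::finite \<Rightarrow> 'a::real_inner"
  defines "m \<equiv> (1 / real CARD('n)) *\<^sub>R (\<Sum>i\<in>UNIV. a i)"
  shows "(\<Sum>i\<in>UNIV. (norm (a i - m))\<^sup>2) \<le> (\<Sum>i\<in>UNIV. (norm (a i))\<^sup>2)"
proof -
  have "(\<Sum>i\<in>UNIV. a i) = real CARD('n) *\<^sub>R m"
    by (simp add: m_def)
  then have "(\<Sum>i\<in>UNIV. a i \<bullet> m) = real CARD('n) * (m \<bullet> m)"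
    by (simp flip: inner_sum_left)
  moreover have "(norm (a i - m))\<^sup>2 = (norm (a i))\<^sup>2 - 2 * (a i \<bullet> m) + m \<bullet> m" for i
    by (simp add: power2_norm_eq_inner inner_diff inner_commute)
  ultimately have "(\<Sum>i\<in>UNIV. (norm (a i - m))\<^sup>2)
      = (\<Sum>i\<in>UNIV. (norm (a i))\<^sup>2) - real CARD('n) * (m \<bullet> m)"
    by (simp add: sum.distrib sum_subtractf flip: sum_distrib_left)
  then show ?thesis by simp
qed

text \<open>Two absorption identities combined. In cross-multiplied form this is the probability
  \<open>b * (n - b) / (n * (n - 1))\<close> that a uniform batch contains one given index and
  misses another.\<close>

lemma choose_minus2_ratio:
  assumes "2 \<le> n" "1 \<le> b" "b \<le> n"
  shows "real n * (real n - 1) * real ((n - 2) choose (b - 1))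
    = real b * (real n - real b) * real (n choose b)"
proof -
  have 1: "b * (n choose b) = n * ((n - 1) choose (b - 1))"
    using assms by (intro times_binomial_minus1_eq) auto
  have 2: "(n - b) * ((n - 1) choose (b - 1)) = (n - 1) * ((n - 2) choose (b - 1))"
  proof -
    have "n - 1 - (b - 1) = n - b" "n - 1 - 1 = n - 2"
      using assms by auto
    with binomial_absorb_comp[of "n - 1" "b - 1"] show ?thesis by simp
  qed
  have "n * ((n - 1) * ((n - 2) choose (b - 1))) = n * ((n - b) * ((n - 1) choose (b - 1)))"
    by (simp only: 2)
  also have "\<dots> = (n - b) * (n * ((n - 1) choose (b - 1)))"
    by (rule mult.left_commute)
  also have "\<dots> = (n - b) * (b * (n choose b))"
    by (simp only: 1)
  finally have "n * ((n - 1) * ((n - 2) choose (b - 1))) = (n - b) * (b * (n choose b))" .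
  then have "real (n * ((n - 1) * ((n - 2) choose (b - 1)))) = real ((n - b) * (b * (n choose b)))"
    by simp
  with assms show ?thesis
    by (simp add: algebra_simps)
qed

section \<open>Expected residual of minibatch sampling\<close>

text \<open>The variance of a batch mean is \<open>(n - b) / ((n - 1) * b)\<close> times the mean
  squared deviation of the component gradients. After the centering is dropped, each squared
  gradient is at most \<open>2 * Lmax\<close> times its own gap, and these gaps average to the gap
  of \<open>average fs\<close>.\<close>

lemma minibatch_expected_residual:
  fixes fs :: "'n::finite \<Rightarrow> 'a::euclidean_space \<Rightarrow> real" and v :: "'w \<Rightarrow> real ^ 'n"
  assumes diff: "\<And>i x. fs i differentiable (at x)"
    and interp: "interpolation fs"
    and n: "2 \<le> CARD('n)"
    and smooth: "\<And>i. L_smooth (Li i) (fs i)" and Lmax: "\<And>i. Li i \<le> Lmax"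
    and mb: "minibatch_sampling b M v"
  shows "expected_residual (minibatch_rho Lmax CARD('n) b) fs M v"
proof -
  let ?n = "real CARD('n)" and ?f = "average fs"
  have b: "1 \<le> b" "b \<le> CARD('n)"
    using mb by (auto simp: minibatch_sampling_def)
  obtain x' where x': "x' \<in> minimizers ?f" "\<And>i. x' \<in> minimizers (fs i)"
    using interp by (auto simp: interpolation_def)
  note grad_0 = interpolation_grad_eq_0[OF diff interp x'(1)]
  have "0 < Li i" for i
    using smooth by (simp add: L_smooth_def)
  then have "0 < Lmax"
    using Lmax less_le_trans by blast
  have \<rho>: "0 \<le> minibatch_rho Lmax CARD('n) b"
    using \<open>0 < Lmax\<close> b n by (auto simp: minibatch_rho_def)
  have "expectation_le M
      (\<lambda>\<omega>. (norm (grad (weighted_average fs (v \<omega>)) x - grad (weighted_average fs (v \<omega>)) x'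
                       - (grad ?f x - grad ?f x')))\<^sup>2)
      (2 * minibatch_rho Lmax CARD('n) b * (?f x - ?f x'))" for x
  proof -
    define a where "a i = grad (fs i) x" for i
    define m where "m = (1 / ?n) *\<^sub>R (\<Sum>i\<in>UNIV. a i)"
    define h where "h w = (norm ((1 / ?n) *\<^sub>R (\<Sum>i\<in>UNIV. (w $ i) *\<^sub>R a i) - m))\<^sup>2"
      for w :: "real ^ 'n"
    have h_eq: "(norm (grad (weighted_average fs (v \<omega>)) x - grad (weighted_average fs (v \<omega>)) x'
        - (grad ?f x - grad ?f x')))\<^sup>2 = h (v \<omega>)" for \<omega>
      by (simp add: h_def m_def a_def grad_weighted_average[OF diff] grad_average[OF diff] grad_0)
    have h: "h \<in> borel_measurable borel"
      unfolding h_def by measurable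
    \<comment> \<open>The weights \<open>n / b\<close> cancel the prefactor \<open>1 / n\<close>; as
      \<open>card S = b\<close>, subtracting \<open>m\<close> once amounts to centering each of the
      \<open>b\<close> gradients.\<close>
    have h_minibatch: "h (minibatch_vector b S) = (norm (\<Sum>i\<in>S. a i - m))\<^sup>2 / (real b)\<^sup>2"
      if "card S = b" for S
    proof -
      have "(\<Sum>i\<in>UNIV. (minibatch_vector b S $ i) *\<^sub>R a i) = (?n / real b) *\<^sub>R (\<Sum>i\<in>S. a i)"
        by (simp add: minibatch_vector_nth if_distrib[of "\<lambda>t. t *\<^sub>R _"] sum.If_cases
            scaleR_sum_right cong: if_cong)
      then have "(1 / ?n) *\<^sub>R (\<Sum>i\<in>UNIV. (minibatch_vector b S $ i) *\<^sub>R a i) - m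
          = (1 / real b) *\<^sub>R (\<Sum>i\<in>S. a i - m)"
        using b that by (simp add: sum_subtractf scaleR_diff_right sum_constant_scaleR)
      then show ?thesis
        by (simp add: h_def power_divide)
    qed
    have "(\<Sum>i\<in>UNIV. a i - m) = 0"
      by (simp add: sum_subtractf m_def sum_constant_scaleR)
    then have "(\<integral>\<omega>. h (v \<omega>) \<partial>M) = real ((CARD('n) - 2) choose (b - 1))
        / ((real b)\<^sup>2 * real (CARD('n) choose b)) * (\<Sum>i\<in>UNIV. (norm (a i - m))\<^sup>2)"
      by (simp add: integral_minibatch_sampling(2)[OF mb h] h_minibatch
          sum_subsets_norm_squared[OF b(1)] flip: sum_divide_distrib)
    also have "real ((CARD('n) - 2) choose (b - 1)) / ((real b)\<^sup>2 * real (CARD('n) choose b))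
        = (?n - real b) / ((?n - 1) * real b * ?n)"
    proof -
      have "real (CARD('n) choose b) > 0" "?n - 1 > 0" "real b > 0" "?n > 0"
        using b n by auto
      with choose_minus2_ratio[OF n b] show ?thesis
        by (simp add: divide_simps power2_eq_square) algebra
    qed
    also have "(?n - real b) / ((?n - 1) * real b * ?n) * (\<Sum>i\<in>UNIV. (norm (a i - m))\<^sup>2)
        \<le> (?n - real b) / ((?n - 1) * real b * ?n) * (\<Sum>i\<in>UNIV. 2 * Lmax * (fs i x - fs i x'))"
    proof (rule mult_left_mono)
      have "(norm (a i))\<^sup>2 \<le> 2 * Lmax * (fs i x - fs i x')" for i
      proof -
        have "(norm (a i))\<^sup>2 \<le> 2 * Li i * (fs i x - fs i x')"
          unfolding a_def by (rule L_smooth_grad_bound[OF smooth x'(2)])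
        also have "\<dots> \<le> 2 * Lmax * (fs i x - fs i x')"
          using x'(2)[of i] Lmax[of i] by (intro mult_right_mono) (auto simp: minimizers_def)
        finally show ?thesis .
      qed
      then have "(\<Sum>i\<in>UNIV. (norm (a i))\<^sup>2) \<le> (\<Sum>i\<in>UNIV. 2 * Lmax * (fs i x - fs i x'))"
        by (rule sum_mono)
      then show "(\<Sum>i\<in>UNIV. (norm (a i - m))\<^sup>2) \<le> (\<Sum>i\<in>UNIV. 2 * Lmax * (fs i x - fs i x'))"
        using sum_norm_squared_centered_le[of a] unfolding m_def by linarith
      show "0 \<le> (?n - real b) / ((?n - 1) * real b * ?n)"
        using b n by auto
    qed
    also have "\<dots> = 2 * minibatch_rho Lmax CARD('n) b * (?f x - ?f x')"
      by (simp add: minibatch_rho_def average_def sum_subtractf flip: sum_distrib_left)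
        (simp add: field_simps)
    finally show ?thesis
      unfolding expectation_le_def h_eq using integral_minibatch_sampling(1)[OF mb h] by simp
  qed
  with \<rho> x'(1) show ?thesis
    unfolding expected_residual_def by blast
qed

section \<open>Optimal batch size\<close>

text \<open>The bound is an affine function of the batch size, so it is optimized at an end point.\<close>

lemma tc_bound_diff:
  assumes "2 \<le> n"
  shows "tc_bound L \<mu> Lmax n \<Delta> \<epsilon> b - tc_bound L \<mu> Lmax n \<Delta> \<epsilon> b'
    = (L / \<mu> * ln (\<Delta> / \<epsilon>)) * ((1 - 2 * (Lmax / \<mu>) / (real n - 1)) * (real b - real b'))"
proof -
  have "real n - 1 \<noteq> 0" using assms by auto
  then show ?thesis
    by (simp add: tc_bound_def diff_divide_distrib algebra_simps)
qed

text \<open>As \<open>\<epsilon> < \<Delta>\<close>, the logarithm is positive, and comparing two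
  batch sizes reduces to the sign of the slope \<open>s\<close>. For \<open>s = 0\<close> all batch
  sizes tie, so uniqueness is claimed away from that case.\<close>

lemma optimal_batch_is_arg_min:
  assumes n: "2 \<le> n" and "0 < L" "0 < \<mu>" "0 < \<epsilon>" "\<epsilon> < \<Delta>"
  shows "is_arg_min (tc_bound L \<mu> Lmax n \<Delta> \<epsilon>) (\<lambda>b. b \<in> {1..n}) (optimal_batch n (Lmax / \<mu>))"
    and "real n - 1 \<noteq> 2 * (Lmax / \<mu>) \<Longrightarrow>
      is_arg_min (tc_bound L \<mu> Lmax n \<Delta> \<epsilon>) (\<lambda>b. b \<in> {1..n}) b \<Longrightarrow> b = optimal_batch n (Lmax / \<mu>)"
proof -
  let ?t = "tc_bound L \<mu> Lmax n \<Delta> \<epsilon>" and ?o = "optimal_batch n (Lmax / \<mu>)"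
  define s where "s = 1 - 2 * (Lmax / \<mu>) / (real n - 1)"
  have c: "0 < L / \<mu> * ln (\<Delta> / \<epsilon>)"
    using assms by (intro mult_pos_pos divide_pos_pos ln_gt_zero) auto
  have o: "?o \<in> {1..n}"
    using n by (auto simp: optimal_batch_def)
  have less: "?t b < ?t b' \<longleftrightarrow> s * (real b - real b') < 0" for b b'
    using c tc_bound_diff[OF n, of L \<mu> Lmax \<Delta> \<epsilon> b b'] unfolding s_def
    by (metis diff_less_0_iff_less mult_less_0_iff not_less_iff_gr_or_eq)
  have "0 < real n - 1" using n by auto
  then have "0 \<le> 1 - K / (real n - 1) \<longleftrightarrow> real n - 1 \<ge> K"
    "1 - K / (real n - 1) = 0 \<longleftrightarrow> real n - 1 = K" for K
    by auto
  then have s: "0 \<le> s \<longleftrightarrow> real n - 1 \<ge> 2 * (Lmax / \<mu>)" "s = 0 \<longleftrightarrow> real n - 1 = 2 * (Lmax / \<mu>)"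
    unfolding s_def by blast+
  have "0 \<le> s * (real b - real ?o)" if "b \<in> {1..n}" for b
    using that s by (auto simp: optimal_batch_def zero_le_mult_iff)
  with o show "is_arg_min ?t (\<lambda>b. b \<in> {1..n}) ?o"
    by (auto simp: is_arg_min_def less not_less)
  assume "real n - 1 \<noteq> 2 * (Lmax / \<mu>)" and b: "is_arg_min ?t (\<lambda>b. b \<in> {1..n}) b"
  then have "\<not> s * (real ?o - real b) < 0" "b \<in> {1..n}" "s \<noteq> 0"
    using o by (auto simp: is_arg_min_def less s)
  then show "b = ?o"
    using s by (auto simp: optimal_batch_def mult_less_0_iff not_less split: if_splits)
qed

section \<open>Iteration complexity\<close>

text \<open>The estimate \<open>1 - t \<le> exp (- t)\<close> with
  \<open>t = max_step L \<mu> \<rho> * \<mu>\<close> turns the geometric rate into exponential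
  decay, which the lower bound on \<open>k\<close> brings down to
  \<open>\<epsilon> / \<Delta>\<close>.\<close>

lemma sgd_iteration_complexity:
  fixes fs :: "'n::finite \<Rightarrow> 'a::euclidean_space \<Rightarrow> real" and v :: "'w \<Rightarrow> real ^ 'n"
  assumes diff: "\<And>i x. fs i differentiable (at x)"
    and samp: "sampling_vector M v" and iid: "iid_copies P vs M v"
    and smooth: "L_smooth L (average fs)" and PL: "PL \<mu> (average fs)"
    and interp: "interpolation fs"
    and ER: "expected_residual \<rho> fs M v"
    and \<epsilon>: "0 < \<epsilon>"
  defines "f \<equiv> average fs"
  assumes k: "real k \<ge> L / \<mu> * (1 + 2 * (\<rho> / \<mu>)) * ln ((f x0 - min_value f) / \<epsilon>)"
  shows "expectation_le P
    (\<lambda>\<omega>. f (sgd fs (\<lambda>_. max_step L \<mu> \<rho>) vs x0 k \<omega>) - min_value f) \<epsilon>"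
proof -
  let ?\<gamma> = "max_step L \<mu> \<rho>"
  define \<Delta> where "\<Delta> = f x0 - min_value f"
  have L: "0 < L" and \<mu>: "0 < \<mu>" and \<rho>: "0 \<le> \<rho>"
    using smooth PL ER by (auto simp: L_smooth_def PL_def expected_residual_def)
  note \<gamma> = max_step_pos[OF L \<mu> \<rho>]
  have rate: "expectation_le P (\<lambda>\<omega>. f (sgd fs (\<lambda>_. ?\<gamma>) vs x0 k \<omega>) - min_value f)
      ((1 - ?\<gamma> * \<mu>) ^ k * \<Delta>)"
    unfolding f_def \<Delta>_def
    by (rule sgd_linear_rate[OF diff samp iid smooth PL interp ER \<gamma> order_refl])
  obtain x' where x': "x' \<in> minimizers f"
    using interp unfolding interpolation_def f_def by blast
  have \<Delta>: "\<Delta> = f x0 - f x'" "0 \<le> \<Delta>"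
    using x' by (auto simp: \<Delta>_def min_value_eq minimizers_def)
  have "(1 - ?\<gamma> * \<mu>) ^ k * \<Delta> \<le> \<epsilon>"
  \<comment> \<open>If \<open>\<Delta>\<close> is nonzero, \<open>x0\<close> lies above the minimum;
    this yields \<open>\<mu> \<le> L\<close> and permits division by
    \<open>\<Delta>\<close>.\<close>
  proof (cases "\<Delta> = 0")
    case False
    with \<Delta> have "0 < \<Delta>" "f x' < f x0" by auto
    then have "\<mu> \<le> L"
      using L_smooth_PL_constants_le[OF smooth PL] x' unfolding f_def by blast
    \<comment> \<open>\<open>C\<close> is the reciprocal of \<open>?\<gamma> * \<mu>\<close>, and
      \<open>1 \<le> C\<close> keeps the base of the power nonnegative.\<close>
    define C where "C = L / \<mu> * (1 + 2 * (\<rho> / \<mu>))"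
    have "1 * 1 \<le> C"
      unfolding C_def using \<open>\<mu> \<le> L\<close> \<mu> \<rho> by (intro mult_mono) auto
    then have C: "1 \<le> C" by simp
    have \<gamma>_eq: "?\<gamma> * \<mu> = 1 / C"
      using L \<mu> by (simp add: max_step_def C_def)
    have "?\<gamma> * \<mu> \<le> 1"
      unfolding \<gamma>_eq using C by simp
    have "C * ln (\<Delta> / \<epsilon>) \<le> real k"
      using k unfolding C_def \<Delta>_def .
    then have "ln (\<Delta> / \<epsilon>) \<le> real k * (?\<gamma> * \<mu>)"
      unfolding \<gamma>_eq using C by (simp add: pos_le_divide_eq mult.commute)
    have "(1 - ?\<gamma> * \<mu>) ^ k \<le> exp (- (?\<gamma> * \<mu>)) ^ k"
      using exp_ge_add_one_self[of "- (?\<gamma> * \<mu>)"] \<open>?\<gamma> * \<mu> \<le> 1\<close> by (intro power_mono) auto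
    also have "\<dots> = exp (- (real k * (?\<gamma> * \<mu>)))"
      by (simp flip: exp_of_nat_mult)
    also have "\<dots> \<le> exp (- ln (\<Delta> / \<epsilon>))"
      using \<open>ln (\<Delta> / \<epsilon>) \<le> _\<close> by simp
    also have "\<dots> = \<epsilon> / \<Delta>"
      using \<open>0 < \<Delta>\<close> \<epsilon> by (simp add: exp_minus)
    finally show ?thesis
      using \<open>0 < \<Delta>\<close> by (simp add: pos_le_divide_eq)
  qed (use \<epsilon> in simp)
  with rate show ?thesis
    by (auto simp: expectation_le_def)
qed

text \<open>The residual condition is a premise of the general rate and complexity claims, whereas
  for minibatches it is derived from the smoothness of the components.\<close>

theorem corollary4p7:
  fixes fs :: "'n::finite \<Rightarrow> real ^ 'd::finite \<Rightarrow> real"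
    and f :: "real ^ 'd \<Rightarrow> real"
    and L \<mu> :: real
    and M :: "'w measure" and v :: "'w \<Rightarrow> real ^ 'n"
    and P :: "'p measure" and vs :: "nat \<Rightarrow> 'p \<Rightarrow> real ^ 'n"
    and x0 :: "real ^ 'd"
  assumes "\<And>i x. fs i differentiable (at x)"
    and "f = average fs"
    and "minimizers f \<noteq> {}"
    and "sampling_vector M v"
    and "iid_copies P vs M v"
    and "L_smooth L f"
    and "PL \<mu> f"
    and "interpolation fs"
  shows
    "(\<forall>\<rho>. expected_residual \<rho> fs M v \<longrightarrow>
        (\<forall>\<gamma>. 0 < \<gamma> \<and> \<gamma> \<le> max_step L \<mu> \<rho> \<longrightarrow>
           (\<forall>k. expectation_le P (\<lambda>\<omega>. f (sgd fs (\<lambda>_. \<gamma>) vs x0 k \<omega>) - min_value f)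
                  ((1 - \<gamma> * \<mu>) ^ k * (f x0 - min_value f)))) \<and>
        (\<forall>\<epsilon> k. 0 < \<epsilon> \<and>
             real k \<ge> L / \<mu> * (1 + 2 * (\<rho> / \<mu>)) * ln ((f x0 - min_value f) / \<epsilon>) \<longrightarrow>
           expectation_le P
             (\<lambda>\<omega>. f (sgd fs (\<lambda>_. max_step L \<mu> \<rho>) vs x0 k \<omega>) - min_value f) \<epsilon>))
     \<and>
     (\<forall>Li Lmax. CARD('n) \<ge> 2 \<and> (\<forall>i. L_smooth (Li i) (fs i)) \<and> Lmax = Max (range Li) \<longrightarrow>
        (\<forall>b \<epsilon> k. minibatch_sampling b M v \<and> 0 < \<epsilon> \<and>
             real k * real b \<ge> tc_bound L \<mu> Lmax CARD('n) (f x0 - min_value f) \<epsilon> b \<longrightarrow>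
           expectation_le P
             (\<lambda>\<omega>. f (sgd fs (\<lambda>_. max_step L \<mu> (minibatch_rho Lmax CARD('n) b)) vs x0 k \<omega>)
                    - min_value f) \<epsilon>) \<and>
        (\<forall>\<epsilon>. 0 < \<epsilon> \<and> \<epsilon> < f x0 - min_value f \<longrightarrow>
           is_arg_min (tc_bound L \<mu> Lmax CARD('n) (f x0 - min_value f) \<epsilon>) (\<lambda>b. b \<in> {1..CARD('n)})
             (optimal_batch CARD('n) (Lmax / \<mu>)) \<and>
           (real CARD('n) - 1 \<noteq> 2 * (Lmax / \<mu>) \<longrightarrow>
              (\<forall>b. is_arg_min (tc_bound L \<mu> Lmax CARD('n) (f x0 - min_value f) \<epsilon>)
                      (\<lambda>b. b \<in> {1..CARD('n)}) b \<longrightarrow> b = optimal_batch CARD('n) (Lmax / \<mu>)))))"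
proof (intro conjI allI impI)
  note f = assms(2)
  note sgd = assms(1,4,5) assms(6-7)[unfolded f] assms(8)
  {
    fix \<rho> \<gamma> :: real and k
    assume "expected_residual \<rho> fs M v" "0 < \<gamma> \<and> \<gamma> \<le> max_step L \<mu> \<rho>"
    then show "expectation_le P (\<lambda>\<omega>. f (sgd fs (\<lambda>_. \<gamma>) vs x0 k \<omega>) - min_value f)
        ((1 - \<gamma> * \<mu>) ^ k * (f x0 - min_value f))"
      unfolding f using sgd_linear_rate[OF sgd] by blast
  next
    fix \<rho> \<epsilon> :: real and k
    assume "expected_residual \<rho> fs M v" "0 < \<epsilon> \<and>
      real k \<ge> L / \<mu> * (1 + 2 * (\<rho> / \<mu>)) * ln ((f x0 - min_value f) / \<epsilon>)"
    then show "expectation_le P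
        (\<lambda>\<omega>. f (sgd fs (\<lambda>_. max_step L \<mu> \<rho>) vs x0 k \<omega>) - min_value f) \<epsilon>"
      unfolding f using sgd_iteration_complexity[OF sgd] by blast
  next
    fix Li :: "'n \<Rightarrow> real" and Lmax \<epsilon> :: real and b k
    assume Li: "CARD('n) \<ge> 2 \<and> (\<forall>i. L_smooth (Li i) (fs i)) \<and> Lmax = Max (range Li)"
      and b: "minibatch_sampling b M v \<and> 0 < \<epsilon> \<and>
        real k * real b \<ge> tc_bound L \<mu> Lmax CARD('n) (f x0 - min_value f) \<epsilon> b"
    then have ER: "expected_residual (minibatch_rho Lmax CARD('n) b) fs M v"
      by (intro minibatch_expected_residual[where Li = Li] assms) auto
    have "0 < real b"
      using b by (simp add: minibatch_sampling_def)
    \<comment> \<open>The factor \<open>b\<close> cancels the one in the denominator of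
      \<open>minibatch_rho\<close>, so the total complexity bound is \<open>b\<close> times the
      iteration bound.\<close>
    then have tc: "tc_bound L \<mu> Lmax CARD('n) (f x0 - min_value f) \<epsilon> b
        = L / \<mu> * (1 + 2 * (minibatch_rho Lmax CARD('n) b / \<mu>))
          * ln ((f x0 - min_value f) / \<epsilon>) * real b"
      by (simp add: tc_bound_def minibatch_rho_def distrib_right distrib_left mult_ac)
    have "real k \<ge> L / \<mu> * (1 + 2 * (minibatch_rho Lmax CARD('n) b / \<mu>))
        * ln ((f x0 - min_value f) / \<epsilon>)"
      by (rule mult_right_le_imp_le[OF _ \<open>0 < real b\<close>]) (use b in \<open>simp only: tc\<close>)
    with b show "expectation_le P
        (\<lambda>\<omega>. f (sgd fs (\<lambda>_. max_step L \<mu> (minibatch_rho Lmax CARD('n) b)) vs x0 k \<omega>)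
          - min_value f) \<epsilon>"
      unfolding f using sgd_iteration_complexity[OF sgd ER] by blast
  next
    fix Li :: "'n \<Rightarrow> real" and Lmax \<epsilon> :: real
    assume "CARD('n) \<ge> 2 \<and> (\<forall>i. L_smooth (Li i) (fs i)) \<and> Lmax = Max (range Li)"
      "0 < \<epsilon> \<and> \<epsilon> < f x0 - min_value f"
    then show "is_arg_min (tc_bound L \<mu> Lmax CARD('n) (f x0 - min_value f) \<epsilon>)
        (\<lambda>b. b \<in> {1..CARD('n)}) (optimal_batch CARD('n) (Lmax / \<mu>))"
      using assms(6,7) by (intro optimal_batch_is_arg_min) (auto simp: L_smooth_def PL_def)
  next
    fix Li :: "'n \<Rightarrow> real" and Lmax \<epsilon> :: real and b
    assume "CARD('n) \<ge> 2 \<and> (\<forall>i. L_smooth (Li i) (fs i)) \<and> Lmax = Max (range Li)"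
      "0 < \<epsilon> \<and> \<epsilon> < f x0 - min_value f" "real CARD('n) - 1 \<noteq> 2 * (Lmax / \<mu>)"
      "is_arg_min (tc_bound L \<mu> Lmax CARD('n) (f x0 - min_value f) \<epsilon>) (\<lambda>b. b \<in> {1..CARD('n)}) b"
    then show "b = optimal_batch CARD('n) (Lmax / \<mu>)"
      using assms(6,7) by (intro optimal_batch_is_arg_min(2)) (auto simp: L_smooth_def PL_def)
  }
qed

end
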